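(* Let $F:\mathbb{R}^n\to\mathbb{R}^n$ be continuously differentiable with Jacobian $J$, and suppose there is $L>0$ such that $\|J(x)-J(y)\|\le L\|x-y\|$ for all $x,y\in\mathbb{R}^n$. Let $\{x_k\}$ be a sequence generated by the CNMTr algorithm (described in the context) with regularization constant $c_\epsilon>0$, and suppose there is a constant $m>0$ such that $\|J(x_k)y\|\ge m\|y\|$ for all $y\in\mathbb{R}^n$ and all $k=0,1,2,\ldots$. If $\mu_k\le c_\epsilon<0.5\,m$ (where $\mu_k$ is the regularization parameter of the algorithm), then $$\liminf_{k\to\infty}\|F(x_k)\|=0.$$
   Context: $\|\cdot\|$ is the Euclidean norm on vectors and its induced norm on matrices; $J(x)=\partial F(x)/\partial x$; $I$ is the identity matrix. CNMTr algorithm. Constants: $\eta_a=10^{-6}$, $\eta_1=0.25$, $\eta_2=0.75$, $\gamma_1=2$, $\gamma_2=0.5$, and a small positive constant $c_\epsilon$. Given a starting point $x_0\in\mathbb{R}^n$ and $\Delta t_0=10^{-2}$, for $k=0,1,2,\ldots$: 1. If $k=0$ or the previous trial step was accepted, let $s_k^P$ be the solution of $(\mu_k I-J(x_k))s_k^P=F(x_k)$, where $\mu_k=c_\epsilon$ if $\Delta t_k\le 1/c_\epsilon$ and $\mu_k=1/\Delta t_k$ otherwise. If the previous trial step was rejected, $s_k^P=s_{k-1}^P$ is reused. 2. Set $s_k=\frac{\Delta t_k}{1+\Delta t_k}s_k^P$; the trial point is $x_k+s_k$. 3. If $\|F(x_k)\|<\|F(x_k)+J(x_k)s_k\|$ set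 $\rho_k=-1$; otherwise set $\rho_k=\dfrac{\|F(x_k)\|-\|F(x_k+s_k)\|}{\|F(x_k)\|-\|F(x_k)+J(x_k)s_k\|}$. 4. Set $\Delta t_{k+1}=\gamma_1\Delta t_k$ if $|1-\rho_k|\le\eta_1$; $\Delta t_{k+1}=\Delta t_k$ if $\eta_1<|1-\rho_k|<\eta_2$; $\Delta t_{k+1}=\gamma_2\Delta t_k$ otherwise. 5. If $\rho_k\ge\eta_a$, accept: $x_{k+1}=x_k+s_k$. Otherwise reject: $x_{k+1}=x_k$. The iteration stops only if $F(x_k)=0$; asymptotic statements concern the case in which an infinite sequence is generated. *)

theory Defs
  imports "HOL-Analysis.Analysis"
begin

text \<open>
  The norm of the type \<open>real^'n^'n\<close> is not the norm induced by the Euclidean norm on vectors.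
\<close>

definition matrix_norm :: "real^'n^'m \<Rightarrow> real" where
  "matrix_norm A = onorm (\<lambda>v. A *v v)"

definition eta_a :: real where "eta_a = 1 / 10 ^ 6"
definition eta_1 :: real where "eta_1 = 1 / 4"
definition eta_2 :: real where "eta_2 = 3 / 4"
definition gamma_1 :: real where "gamma_1 = 2"
definition gamma_2 :: real where "gamma_2 = 1 / 2"
definition initial_dt :: real where "initial_dt = 1 / 10 ^ 2"

definition regularization :: "real \<Rightarrow> real \<Rightarrow> real" where
  "regularization c dt = (if dt \<le> 1 / c then c else 1 / dt)"

text \<open>
  A vanishing denominator, which leaves the ratio undefined on paper, gives the value 0 here.
  It cannot occur along a run with \<open>F (x k) \<noteq> 0\<close>, \<open>norm (J (x k) *v y) \<ge> m * norm y\<close> and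
  \<open>0 < mu k < m / 2\<close>.
\<close>

definition gain_ratio ::
    "(real^'n \<Rightarrow> real^'n) \<Rightarrow> (real^'n \<Rightarrow> real^'n^'n) \<Rightarrow> real^'n \<Rightarrow> real^'n \<Rightarrow> real" where
  "gain_ratio F J x s =
     (if norm (F x) < norm (F x + J x *v s) then - 1
      else (norm (F x) - norm (F (x + s))) / (norm (F x) - norm (F x + J x *v s)))"

definition next_dt :: "real \<Rightarrow> real \<Rightarrow> real" where
  "next_dt rho dt =
     (if \<bar>1 - rho\<bar> \<le> eta_1 then gamma_1 * dt
      else if \<bar>1 - rho\<bar> < eta_2 then dt
      else gamma_2 * dt)"

text \<open>
  An infinite run of the method with Jacobian \<open>J\<close> and constant \<open>c\<close>, from the arbitrary starting
  point \<open>x 0\<close>. Since the method stops exactly at a zero of \<open>F\<close>, a run is infinite only if no iterate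
  is a zero. The trial step of iteration \<open>k\<close> is accepted iff \<open>eta_a \<le> rho k\<close>. The value \<open>mu k\<close>
  is only used in iterations that compute a new \<open>sP k\<close>.
\<close>

definition CNMTr_run ::
    "(real^'n \<Rightarrow> real^'n) \<Rightarrow> (real^'n \<Rightarrow> real^'n^'n) \<Rightarrow> real \<Rightarrow>
     (nat \<Rightarrow> real^'n) \<Rightarrow> (nat \<Rightarrow> real) \<Rightarrow> (nat \<Rightarrow> real) \<Rightarrow>
     (nat \<Rightarrow> real^'n) \<Rightarrow> (nat \<Rightarrow> real^'n) \<Rightarrow> (nat \<Rightarrow> real) \<Rightarrow> bool" where
  "CNMTr_run F J c x dt mu sP s rho \<longleftrightarrow>
     dt 0 = initial_dt \<and>
     (\<forall>k. F (x k) \<noteq> 0 \<and>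
          mu k = regularization c (dt k) \<and>
          (if k = 0 \<or> eta_a \<le> rho (k - 1)
           then (mu k *\<^sub>R mat 1 - J (x k)) *v sP k = F (x k)
           else sP k = sP (k - 1)) \<and>
          s k = (dt k / (1 + dt k)) *\<^sub>R sP k \<and>
          rho k = gain_ratio F J (x k) (s k) \<and>
          dt (Suc k) = next_dt (rho k) (dt k) \<and>
          x (Suc k) = (if eta_a \<le> rho k then x k + s k else x k))"

end

theory Submission
  imports Defs
begin

text \<open>
  Write \<open>N k = norm (F (x k))\<close> and \<open>t = dt k / (1 + dt k)\<close>. Since \<open>J (x k)\<close> expands every vector by
  at least \<open>m\<close>, the shifted matrix \<open>mu I - J (x k)\<close> with \<open>0 < mu \<le> c\<close> expands by at least
  \<open>m - c\<close>; here \<open>mu\<close> is the shift that was current when the step was computed. Hence the step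
  \<open>p = sP k\<close> satisfies \<open>norm p \<le> N k / (m - c)\<close>. Because \<open>J (x k) p = mu p - F (x k)\<close>, the
  linear model is \<open>F + J s = (1 - t) F + t mu p\<close>, whose norm is at most
  \<open>(1 - t + t c / (m - c)) N k\<close>. This is where \<open>c < m / 2\<close> enters: it makes
  \<open>c / (m - c) < 1\<close>, so the model predicts a decrease of at least the fraction
  \<open>t (m - 2 c) / (m - c)\<close> of the residual (lemma \<open>model_reduction\<close>).

  The model error is quadratic in \<open>s\<close>, hence in \<open>t\<close>, while the predicted decrease is linear
  in \<open>t\<close>. So \<open>\<bar>1 - rho k\<bar>\<close> is at most a constant times \<open>dt k\<close> (lemma \<open>gain_ratio_near_one\<close>).
  The constant contains \<open>N k\<close>, but an accepted step decreases the residual and a rejected one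
  keeps it, so \<open>N k \<le> N 0\<close>. Consequently a small \<open>dt k\<close> is always doubled, which keeps \<open>dt\<close> away
  from \<open>0\<close> (lemma \<open>dt_bounded_below\<close>). Rejections halve \<open>dt\<close>, so infinitely many steps must be
  accepted (lemma \<open>infinitely_many_accepted\<close>), and each of these shrinks the residual by
  at least a fixed fraction. A nonnegative decreasing sequence with this property tends to \<open>0\<close>.
  The argument thus gives convergence of the whole residual sequence.
\<close>

section \<open>A single trial step\<close>

text \<open>
  The mean value inequality for \<open>F\<close> minus its linearization at \<open>a\<close>. Bounding the variation of \<open>J\<close>
  on the whole segment by its maximum loses a factor \<open>2\<close> against the integral form.
\<close>

lemma linearization_error:
  fixes F :: "real^'n \<Rightarrow> real^'m" and J :: "real^'n \<Rightarrow> real^'n^'m"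
  assumes deriv: "\<And>z. (F has_derivative (\<lambda>h. J z *v h)) (at z)"
    and lip: "\<And>y z. matrix_norm (J y - J z) \<le> L * norm (y - z)"
    and "L \<ge> 0"
  shows "norm (F (a + h) - (F a + J a *v h)) \<le> L * (norm h)\<^sup>2"
proof -
  let ?S = "closed_segment a (a + h)"
  have "norm (F (a + h) - F a - J a *v (a + h - a)) \<le> norm (a + h - a) * (L * norm h)"
  proof (rule differentiable_bound_linearization[where S = ?S and f' = "\<lambda>z h. J z *v h" and ?x0.0 = a])
    show "a + t *\<^sub>R (a + h - a) \<in> ?S" if "t \<in> {0..1}" for t
      using that by (auto simp: in_segment algebra_simps)
    show "(F has_derivative (\<lambda>h. J z *v h)) (at z within ?S)" for z
      by (rule has_derivative_at_withinI[OF deriv])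
    show "onorm ((\<lambda>v. J z *v v) - (\<lambda>v. J a *v v)) \<le> L * norm h" if "z \<in> ?S" for z
    proof -
      have "onorm ((\<lambda>v. J z *v v) - (\<lambda>v. J a *v v)) = matrix_norm (J z - J a)"
        by (simp add: matrix_norm_def fun_diff_def matrix_vector_mult_diff_rdistrib)
      also have "\<dots> \<le> L * norm (z - a)" by (rule lip)
      also have "\<dots> \<le> L * norm h"
        using segment_bound1[OF that] \<open>L \<ge> 0\<close> by (intro mult_left_mono) auto
      finally show ?thesis .
    qed
  qed auto
  then show ?thesis by (simp add: power2_eq_square diff_diff_eq mult_ac)
qed

lemma regularized_step_norm_le:
  fixes A :: "real^'n^'n"
  assumes expand: "\<And>y. m * norm y \<le> norm (A *v y)"
    and solve: "(\<mu> *\<^sub>R mat 1 - A) *v p = b"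
    and "0 \<le> \<mu>" "\<mu> \<le> c" "c < m"
  shows "norm p \<le> norm b / (m - c)"
proof -
  have Ap: "A *v p = \<mu> *\<^sub>R p - b"
    using solve by (auto simp: matrix_vector_mult_diff_rdistrib scaleR_matrix_vector_assoc[symmetric])
  have "m * norm p \<le> norm (\<mu> *\<^sub>R p - b)" using expand[of p] Ap by simp
  also have "\<dots> \<le> \<mu> * norm p + norm b"
    using norm_triangle_ineq4[of "\<mu> *\<^sub>R p" b] \<open>0 \<le> \<mu>\<close> by simp
  also have "\<dots> \<le> c * norm p + norm b" using \<open>\<mu> \<le> c\<close> by (simp add: mult_right_mono)
  finally show ?thesis using \<open>c < m\<close> by (simp add: pos_le_divide_eq algebra_simps)
qed

text \<open>
  The vector \<open>b + A (t p)\<close> equals \<open>(1 - t) b + t \<mu> p\<close>, a convex combination of \<open>b\<close> with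
  \<open>\<mu> p\<close>, whose norm is at most \<open>c / (m - c)\<close> times that of \<open>b\<close>.
\<close>

lemma model_reduction:
  fixes A :: "real^'n^'n"
  assumes expand: "\<And>y. m * norm y \<le> norm (A *v y)"
    and solve: "(\<mu> *\<^sub>R mat 1 - A) *v p = b"
    and "0 \<le> \<mu>" "\<mu> \<le> c" "c < m" "0 \<le> t" "t \<le> 1"
  shows "t * ((m - 2 * c) / (m - c)) * norm b \<le> norm b - norm (b + A *v (t *\<^sub>R p))"
proof -
  have Ap: "A *v p = \<mu> *\<^sub>R p - b"
    using solve by (auto simp: matrix_vector_mult_diff_rdistrib scaleR_matrix_vector_assoc[symmetric])
  have "b + A *v (t *\<^sub>R p) = (1 - t) *\<^sub>R b + (t * \<mu>) *\<^sub>R p"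
    by (simp add: matrix_vector_mult_scaleR Ap algebra_simps)
  then have "norm (b + A *v (t *\<^sub>R p)) \<le> (1 - t) * norm b + t * (\<mu> * norm p)"
    using norm_triangle_ineq[of "(1 - t) *\<^sub>R b" "(t * \<mu>) *\<^sub>R p"] assms by (simp add: mult.assoc)
  also have "\<mu> * norm p \<le> c * (norm b / (m - c))"
    using regularized_step_norm_le[OF assms(1-5)] assms by (intro mult_mono) auto
  then have "(1 - t) * norm b + t * (\<mu> * norm p) \<le> (1 - t) * norm b + t * (c * (norm b / (m - c)))"
    using \<open>0 \<le> t\<close> by (intro add_left_mono mult_left_mono)
  finally have "norm (b + A *v (t *\<^sub>R p)) \<le> (1 - t) * norm b + t * (c * (norm b / (m - c)))" .
  moreover have "(1 - t) * norm b + t * (c * (norm b / (m - c)))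
      = norm b - t * ((m - 2 * c) / (m - c)) * norm b"
    using \<open>c < m\<close> by (simp add: divide_simps) (simp add: algebra_simps)
  ultimately show ?thesis by linarith
qed

lemma gain_ratio_eq:
  assumes "norm (F x + J x *v s) \<le> norm (F x)"
  shows "gain_ratio F J x s = (norm (F x) - norm (F (x + s))) / (norm (F x) - norm (F x + J x *v s))"
  using assms by (simp add: gain_ratio_def)

text \<open>
  The deviation of the ratio from \<open>1\<close> is the model error, of order \<open>t\<^sup>2\<close>, divided by the predicted
  decrease, of order \<open>t\<close>.
\<close>

lemma gain_ratio_near_one:
  fixes F :: "real^'n \<Rightarrow> real^'n" and J :: "real^'n \<Rightarrow> real^'n^'n"
  assumes deriv: "\<And>z. (F has_derivative (\<lambda>h. J z *v h)) (at z)"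
    and lip: "\<And>y z. matrix_norm (J y - J z) \<le> L * norm (y - z)"
    and "L \<ge> 0"
    and expand: "\<And>y. m * norm y \<le> norm (J x *v y)"
    and solve: "(\<mu> *\<^sub>R mat 1 - J x) *v p = F x"
    and "0 \<le> \<mu>" "\<mu> \<le> c" "2 * c < m" "0 < t" "t \<le> 1" "F x \<noteq> 0"
  shows "\<bar>1 - gain_ratio F J x (t *\<^sub>R p)\<bar> \<le> t * (L * norm (F x) / ((m - c) * (m - 2 * c)))"
proof -
  define N where "N = norm (F x)"
  define pred where "pred = N - norm (F x + J x *v (t *\<^sub>R p))"
  have "c < m" using assms by linarith
  have "N > 0" using \<open>F x \<noteq> 0\<close> by (simp add: N_def)
  have pred: "t * ((m - 2 * c) / (m - c)) * N \<le> pred"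
    unfolding pred_def N_def
    by (rule model_reduction[OF expand solve]) (use assms \<open>c < m\<close> in auto)
  have low_pos: "0 < t * ((m - 2 * c) / (m - c)) * N"
    using assms \<open>c < m\<close> \<open>N > 0\<close> by simp
  then have "pred > 0" using pred by linarith
  have "norm (t *\<^sub>R p) \<le> t * (N / (m - c))"
    using regularized_step_norm_le[OF expand solve \<open>0 \<le> \<mu>\<close> \<open>\<mu> \<le> c\<close> \<open>c < m\<close>] \<open>0 < t\<close>
    unfolding N_def by (simp only: norm_scaleR abs_of_pos) (intro mult_left_mono, auto)
  then have "L * (norm (t *\<^sub>R p))\<^sup>2 \<le> L * (t * (N / (m - c)))\<^sup>2"
    using \<open>L \<ge> 0\<close> by (intro mult_left_mono power_mono) auto
  then have err: "norm (F (x + t *\<^sub>R p) - (F x + J x *v (t *\<^sub>R p))) \<le> L * (t * (N / (m - c)))\<^sup>2"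
    using linearization_error[OF deriv lip \<open>L \<ge> 0\<close>, of x "t *\<^sub>R p"] by linarith
  have "gain_ratio F J x (t *\<^sub>R p) = (N - norm (F (x + t *\<^sub>R p))) / pred"
    using \<open>pred > 0\<close> by (simp add: gain_ratio_eq pred_def N_def)
  then have "1 - gain_ratio F J x (t *\<^sub>R p)
      = (norm (F (x + t *\<^sub>R p)) - norm (F x + J x *v (t *\<^sub>R p))) / pred"
    using \<open>pred > 0\<close> by (simp add: field_simps) (simp add: pred_def)
  then have "\<bar>1 - gain_ratio F J x (t *\<^sub>R p)\<bar>
      = \<bar>norm (F (x + t *\<^sub>R p)) - norm (F x + J x *v (t *\<^sub>R p))\<bar> / pred"
    using \<open>pred > 0\<close> by simp
  also have "\<dots> \<le> L * (t * (N / (m - c)))\<^sup>2 / (t * ((m - 2 * c) / (m - c)) * N)"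
    using norm_triangle_ineq3[of "F (x + t *\<^sub>R p)" "F x + J x *v (t *\<^sub>R p)"] err pred low_pos \<open>L \<ge> 0\<close>
    by (intro frac_le) auto
  also have "\<dots> = t * (L * N / ((m - c) * (m - 2 * c)))"
    using \<open>0 < t\<close> \<open>c < m\<close> \<open>2 * c < m\<close> \<open>N > 0\<close> by (simp add: divide_simps power2_eq_square)
  finally show ?thesis by (simp add: N_def)
qed

section \<open>The time step control\<close>

text \<open>
  Below \<open>\<delta>\<close> the time step only grows, and above \<open>\<delta>\<close> a single update at worst halves it.
\<close>

lemma dt_bounded_below:
  assumes "d 0 > 0" "\<delta> > 0"
    and next_d: "\<And>k. d (Suc k) = next_dt (\<rho> k) (d k)"
    and good: "\<And>k. 0 < d k \<Longrightarrow> d k \<le> \<delta> \<Longrightarrow> \<bar>1 - \<rho> k\<bar> \<le> eta_1"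
  shows "min (d 0) (\<delta> / 2) \<le> d k"
proof (induction k)
  case (Suc k)
  have "d k > 0" using Suc assms(1,2) by (auto simp: min_def split: if_splits)
  show ?case
  proof (cases "d k \<le> \<delta>")
    case True
    with good \<open>d k > 0\<close> have "d (Suc k) = 2 * d k"
      by (simp add: next_d next_dt_def gamma_1_def)
    with Suc \<open>d k > 0\<close> show ?thesis by linarith
  next
    case False
    moreover have "d (Suc k) \<ge> d k / 2"
      using \<open>d k > 0\<close> by (simp add: next_d next_dt_def gamma_1_def gamma_2_def)
    ultimately show ?thesis by linarith
  qed
qed simp

text \<open>
  A rejected step has \<open>\<rho> < eta_a < 1 - eta_2\<close>, so it halves the time step. An endless series of
  rejections would drive the time step to \<open>0\<close>.
\<close>

lemma infinitely_many_accepted: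
  assumes "l > 0" and low: "\<And>k. l \<le> d k"
    and next_d: "\<And>k. d (Suc k) = next_dt (\<rho> k) (d k)"
  shows "\<exists>k\<ge>K. eta_a \<le> \<rho> k"
proof (rule ccontr)
  assume "\<not> ?thesis"
  then have rej: "\<rho> k < eta_a" if "k \<ge> K" for k using that by force
  have half: "d (Suc k) = d k / 2" if "k \<ge> K" for k
    using rej[OF that]
    by (simp add: next_d next_dt_def eta_a_def eta_1_def eta_2_def gamma_2_def)
  have geom: "d (K + j) = d K * (1 / 2) ^ j" for j
    by (induction j) (simp_all add: half)
  have "(\<lambda>j. d K * (1 / 2) ^ j) \<longlonglongrightarrow> d K * 0"
    by (intro tendsto_intros LIMSEQ_realpow_zero) auto
  then have "l \<le> 0"
    using low by (intro LIMSEQ_le_const) (auto simp: geom[symmetric])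
  then show False using \<open>l > 0\<close> by simp
qed

section \<open>Convergence of the residuals\<close>

lemma decreasing_tendsto_zero:
  fixes N :: "nat \<Rightarrow> real"
  assumes nonneg: "\<And>k. 0 \<le> N k" and dec: "\<And>k. N (Suc k) \<le> N k"
    and "\<kappa> > 0" and shrink: "\<And>K. \<exists>k\<ge>K. N (Suc k) \<le> N k - \<kappa> * N k"
  shows "N \<longlonglongrightarrow> 0"
proof -
  have "decseq N" using dec by (rule decseq_SucI)
  then obtain l where lim: "N \<longlonglongrightarrow> l" and ge: "\<And>k. l \<le> N k"
    using decseq_convergent[of N 0] nonneg by blast
  have "0 \<le> l" using lim nonneg by (intro LIMSEQ_le_const) auto
  have "\<not> l > 0"
  proof
    assume "l > 0"
    have "(\<lambda>k. N k - N (Suc k)) \<longlonglongrightarrow> l - l"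
      using lim by (intro tendsto_diff LIMSEQ_Suc)
    then have "\<forall>\<^sub>F k in sequentially. N k - N (Suc k) < \<kappa> * l"
      using \<open>\<kappa> > 0\<close> \<open>l > 0\<close> by (intro order_tendstoD(2)) auto
    then obtain K where K: "\<And>k. k \<ge> K \<Longrightarrow> N k - N (Suc k) < \<kappa> * l"
      by (auto simp: eventually_sequentially)
    obtain k where "k \<ge> K" "N (Suc k) \<le> N k - \<kappa> * N k" using shrink by blast
    moreover have "\<kappa> * l \<le> \<kappa> * N k" using \<open>\<kappa> > 0\<close> ge by simp
    ultimately show False using K[of k] by linarith
  qed
  with \<open>0 \<le> l\<close> lim show ?thesis by simp
qed

lemma CNMTr_run_dt_pos:
  assumes "CNMTr_run F J c x dt mu sP s rho"
  shows "dt k > 0"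
  by (induction k)
    (use assms in \<open>auto simp: CNMTr_run_def initial_dt_def next_dt_def gamma_1_def gamma_2_def\<close>)

text \<open>
  After a rejection \<open>sP\<close> is reused although \<open>mu\<close> may have changed. The iterate has not moved, so the
  reused vector still solves a system at the current iterate, with the value of \<open>mu\<close> from the
  iteration that computed it.
\<close>

lemma CNMTr_run_step_equation:
  assumes run: "CNMTr_run F J c x dt mu sP s rho" and "c > 0"
    and mu_le: "\<And>k. mu k \<le> c"
  shows "\<exists>\<mu>. 0 < \<mu> \<and> \<mu> \<le> c \<and> (\<mu> *\<^sub>R mat 1 - J (x k)) *v sP k = F (x k)"
proof -
  have mu_pos: "0 < mu k" for k
  proof -
    have "mu k = regularization c (dt k)" using run by (simp add: CNMTr_run_def)
    then show ?thesis
      using CNMTr_run_dt_pos[OF run, of k] \<open>c > 0\<close> by (simp add: regularization_def)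
  qed
  show ?thesis
  proof (induction k)
    case 0
    have "(mu 0 *\<^sub>R mat 1 - J (x 0)) *v sP 0 = F (x 0)"
      using run unfolding CNMTr_run_def by metis
    then show ?case using mu_pos mu_le by blast
  next
    case (Suc k)
    show ?case
    proof (cases "eta_a \<le> rho k")
      case True
      then have "(mu (Suc k) *\<^sub>R mat 1 - J (x (Suc k))) *v sP (Suc k) = F (x (Suc k))"
        using run unfolding CNMTr_run_def by (metis diff_Suc_1)
      then show ?thesis using mu_pos mu_le by blast
    next
      case False
      have "if Suc k = 0 \<or> eta_a \<le> rho (Suc k - 1)
           then (mu (Suc k) *\<^sub>R mat 1 - J (x (Suc k))) *v sP (Suc k) = F (x (Suc k))
           else sP (Suc k) = sP (Suc k - 1)"
        using run unfolding CNMTr_run_def by blast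
      then have "sP (Suc k) = sP k" using False by simp
      moreover have "x (Suc k) = x k" using run False by (simp add: CNMTr_run_def)
      ultimately show ?thesis using Suc by simp
    qed
  qed
qed

theorem theorem1:
  fixes F :: "real^'n \<Rightarrow> real^'n"
    and J :: "real^'n \<Rightarrow> real^'n^'n"
    and x sP s :: "nat \<Rightarrow> real^'n"
    and dt mu rho :: "nat \<Rightarrow> real"
    and c L m :: real
  assumes "\<forall>z. (F has_derivative (\<lambda>h. J z *v h)) (at z)"
    and "continuous_on UNIV J"
    and "L > 0"
    and "\<forall>y z. matrix_norm (J y - J z) \<le> L * norm (y - z)"
    and "c > 0"
    and "CNMTr_run F J c x dt mu sP s rho"
    and "m > 0"
    and "\<forall>k y. norm (J (x k) *v y) \<ge> m * norm y"
    and "\<forall>k. mu k \<le> c"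
    and "c < m / 2"
  shows "liminf (\<lambda>k. ereal (norm (F (x k)))) = 0"
proof -
  note run = \<open>CNMTr_run F J c x dt mu sP s rho\<close>
  define N where "N k = norm (F (x k))" for k
  define t where "t k = dt k / (1 + dt k)" for k
  define \<theta> where "\<theta> = (m - 2 * c) / (m - c)"
  have "c < m" "2 * c < m" using assms by linarith+
  then have "\<theta> > 0" by (simp add: \<theta>_def)
  have nz: "F (x k) \<noteq> 0"
    and s: "s k = t k *\<^sub>R sP k"
    and rho: "rho k = gain_ratio F J (x k) (s k)"
    and dt_Suc: "dt (Suc k) = next_dt (rho k) (dt k)"
    and x_Suc: "x (Suc k) = (if eta_a \<le> rho k then x k + s k else x k)" for k
    using run by (simp_all add: CNMTr_run_def t_def)
  have N_pos: "N k > 0" for k using nz by (simp add: N_def)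
  have dt_pos: "dt k > 0" for k by (rule CNMTr_run_dt_pos[OF run])
  have t_pos: "0 < t k" and t_le_1: "t k \<le> 1" and t_le_dt: "t k \<le> dt k" for k
    using dt_pos[of k] by (simp_all add: t_def field_simps)
  have step: "\<exists>\<mu>. 0 < \<mu> \<and> \<mu> \<le> c \<and> (\<mu> *\<^sub>R mat 1 - J (x k)) *v sP k = F (x k)" for k
    using CNMTr_run_step_equation[OF run \<open>c > 0\<close>] assms by blast

  have pred: "t k * \<theta> * N k \<le> N k - norm (F (x k) + J (x k) *v s k)" for k
  proof -
    obtain \<mu> where "0 < \<mu>" "\<mu> \<le> c" "(\<mu> *\<^sub>R mat 1 - J (x k)) *v sP k = F (x k)"
      using step by blast
    then show ?thesis
      unfolding N_def \<theta>_def s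
      using assms \<open>c < m\<close> t_pos[of k] t_le_1[of k]
      by (intro model_reduction[where \<mu> = \<mu>]) auto
  qed
  have accept: "N (Suc k) \<le> N k - eta_a * (t k * \<theta> * N k)" if "eta_a \<le> rho k" for k
  proof -
    have pred_pos: "0 < t k * \<theta> * N k" using t_pos \<open>\<theta> > 0\<close> N_pos by simp
    let ?p = "N k - norm (F (x k) + J (x k) *v s k)"
    have "?p > 0" using pred[of k] pred_pos by linarith
    then have "rho k = (N k - norm (F (x k + s k))) / ?p"
      by (simp add: rho gain_ratio_eq N_def)
    then have "N k - N (Suc k) = rho k * ?p"
      using \<open>?p > 0\<close> that by (simp add: x_Suc N_def)
    moreover have "eta_a * (t k * \<theta> * N k) \<le> rho k * ?p"
      using that pred[of k] pred_pos by (intro mult_mono) (auto simp: eta_a_def)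
    ultimately show ?thesis by linarith
  qed
  have dec: "N (Suc k) \<le> N k" for k
  proof (cases "eta_a \<le> rho k")
    case True
    moreover have "0 \<le> eta_a * (t k * \<theta> * N k)"
      using t_pos[of k] \<open>\<theta> > 0\<close> N_pos[of k] by (simp add: eta_a_def)
    ultimately show ?thesis using accept[of k] by linarith
  qed (simp add: N_def x_Suc)
  then have N_le: "N k \<le> N 0" for k
    using decseq_SucI[of N] by (simp add: decseq_def)

  \<comment> \<open>The time step at which the bound \<open>L * dt * N 0 / ((m - c) * (m - 2 * c))\<close> on
    \<open>\<bar>1 - rho\<bar>\<close> reaches \<open>eta_1\<close>.\<close>
  define \<delta> where "\<delta> = eta_1 * ((m - c) * (m - 2 * c)) / (L * N 0)"
  have "\<delta> > 0"
    using \<open>c < m\<close> \<open>2 * c < m\<close> \<open>L > 0\<close> N_pos[of 0] by (simp add: \<delta>_def eta_1_def)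
  have good: "\<bar>1 - rho k\<bar> \<le> eta_1" if "dt k \<le> \<delta>" for k
  proof -
    obtain \<mu> where "0 < \<mu>" "\<mu> \<le> c" "(\<mu> *\<^sub>R mat 1 - J (x k)) *v sP k = F (x k)"
      using step by blast
    then have "\<bar>1 - rho k\<bar> \<le> t k * (L * N k / ((m - c) * (m - 2 * c)))"
      unfolding N_def rho s
      using assms \<open>2 * c < m\<close> t_pos[of k] t_le_1[of k] nz[of k]
      by (intro gain_ratio_near_one[where \<mu> = \<mu>]) auto
    also have "\<dots> \<le> \<delta> * (L * N 0 / ((m - c) * (m - 2 * c)))"
      using t_le_dt[of k] that N_le[of k] N_pos[of k] \<open>c < m\<close> \<open>2 * c < m\<close> \<open>L > 0\<close> \<open>\<delta> > 0\<close>
      by (intro mult_mono divide_right_mono) auto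
    also have "\<dots> = eta_1"
      using \<open>c < m\<close> \<open>2 * c < m\<close> \<open>L > 0\<close> N_pos[of 0] by (simp add: \<delta>_def)
    finally show ?thesis .
  qed
  define l where "l = min (dt 0) (\<delta> / 2)"
  have "l > 0" using dt_pos \<open>\<delta> > 0\<close> by (simp add: l_def)
  have dt_low: "l \<le> dt k" for k
    unfolding l_def using dt_bounded_below[where d = dt and \<rho> = rho, OF dt_pos \<open>\<delta> > 0\<close> dt_Suc good] .
  have t_low: "l / (1 + l) \<le> t k" for k
    using dt_low[of k] \<open>l > 0\<close> by (simp add: t_def field_simps)

  have "N \<longlonglongrightarrow> 0"
  proof (rule decreasing_tendsto_zero)
    show "0 < eta_a * (l / (1 + l) * \<theta>)"
      using \<open>l > 0\<close> \<open>\<theta> > 0\<close> by (simp add: eta_a_def)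
    show "\<exists>k\<ge>K. N (Suc k) \<le> N k - eta_a * (l / (1 + l) * \<theta>) * N k" for K
    proof -
      obtain k where k: "k \<ge> K" "eta_a \<le> rho k"
        using infinitely_many_accepted[where d = dt and \<rho> = rho, OF \<open>l > 0\<close> dt_low dt_Suc] by blast
      have "eta_a * (l / (1 + l) * \<theta> * N k) \<le> eta_a * (t k * \<theta> * N k)"
        using t_low \<open>\<theta> > 0\<close> N_pos[of k] by (intro mult_left_mono mult_right_mono) (auto simp: eta_a_def)
      with accept[OF k(2)] have "N (Suc k) \<le> N k - eta_a * (l / (1 + l) * \<theta>) * N k"
        by (simp add: mult.assoc)
      with k(1) show ?thesis by blast
    qed
  qed (use N_pos dec in \<open>auto intro: less_imp_le\<close>)
  then have "(\<lambda>k. ereal (N k)) \<longlonglongrightarrow> ereal 0" by simp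
  then have "liminf (\<lambda>k. ereal (N k)) = ereal 0"
    by (rule lim_imp_Liminf[OF sequentially_bot])
  then show ?thesis by (simp add: N_def zero_ereal_def)
qed

end
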